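(* Let $(\phi_t)_{t\ge0}$ be a semigroup of holomorphic self-maps of $\mathbb{D}$ that is not a group, and let $\Delta$ be a petal of $(\phi_t)$. For $z\in\Delta$ and the geodesic $\eta$ associated with $z$ and $\Delta$, let $v_\Delta(t)=d_{\mathbb{D}}(z,\phi_t(z))$, $v^o_\Delta(t)=d_{\mathbb{D}}(z,\pi_\eta(\phi_t(z)))$ and $v^T_\Delta(t)=d_{\mathbb{D}}(\phi_t(z),\eta)$, $t\le0$, be the total, orthogonal and tangential speeds of $\Delta$. Then $$v^o_\Delta(t)+v^T_\Delta(t)-\frac12\log2\le v_\Delta(t)\le v^o_\Delta(t)+v^T_\Delta(t),$$ for all $t\le0$.
   Context: $\mathbb{D}$ is the unit disk, and $d_{\mathbb{D}}(z,w)=\operatorname{arctanh}\left|\frac{z-w}{1-\bar z w}\right|$ is its hyperbolic distance. A semigroup in $\mathbb{D}$ is a family $(\phi_t)_{t\ge0}$ of holomorphic self-maps of $\mathbb{D}$ with $\phi_0=\mathrm{id}$, $\phi_{t+s}=\phi_t\circ\phi_s$ for all $t,s\ge0$, and $\phi_t(z)\to z$ uniformly on compacta as $t\to0^+$. It is a group if some (equivalently every) $\phi_{t_0}$, $t_0>0$, is an automorphism of $\mathbb{D}$. If it is not a group, there is a unique $\tau\in\overline{\mathbb{D}}$ (the Denjoy--Wolff point) with $\phi_t(z)\to\tau$ as $t\to+\infty$ for all $z\in\mathbb{D}$; the semigroup is elliptic if $\tau\in\mathbb{D}$ and non-elliptic if $\tau\in\partial\mathbb{D}$. A boundary fixed point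 is a point $\sigma\in\partial\mathbb{D}$ with $\angle\lim_{z\to\sigma}\phi_t(z)=\sigma$ for all $t\ge0$; it is regular if the angular derivative $\phi_t'(\sigma)$ is finite for all $t\ge0$. A repelling fixed point is a regular boundary fixed point different from $\tau$. The backward invariant set is $\mathcal{W}=\bigcap_{t\ge0}\phi_t(\mathbb{D})$. A petal is a non-empty connected component $\Delta$ of the interior of $\mathcal{W}$. Each $\phi_t$ ($t\ge 0$) restricts to an automorphism of $\Delta$; for $z\in\Delta$ and $t\le0$ one writes $\phi_t(z):=(\phi_{-t}|_\Delta)^{-1}(z)$. The curve $t\mapsto\phi_t(z)$, $t\le0$, is the backward orbit of $z$. A non-elliptic semigroup has a unique Koenigs function: a univalent holomorphic $h:\mathbb{D}\to\mathbb{C}$ with $h(0)=0$ and $h(\phi_t(z))=h(z)+t$ for all $z\in\mathbb D$, $t\ge0$. A petal $\Delta$ of a non-elliptic semigroup is hyperbolic if $h(\Delta)$ is a maximal horizontal strip in $h(\mathbb{D})$, and parabolic if $h(\Delta)$ is a maximal horizontal half-plane in $h(\mathbb{D})$ (one of the two always holds). Every petal of an elliptic semigroup is called hyperbolic. All backward orbits in a hyperbolic petal converge, as $t\to-\infty$, to one and the same repelling fixed point $\sigma$; all backward orbits in a parabolic petal converge to $\tau$. Given $z\in\Delta$, $\eta:(-1,1)\to\mathbb{D}$ denotes the (full) geodesic of $d_{\mathbb{D}}$ with $\eta(0)=z$ and $\lim_{r\to1^-}\eta(r)=\sigma$ if $\Delta$ is hyperbolic, respectively $\lim_{r\to1^-}\eta(r)=\tau$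 if $\Delta$ is parabolic. For $w\in\mathbb{D}$, $d_{\mathbb{D}}(w,\eta):=\inf_{r\in(-1,1)}d_{\mathbb{D}}(w,\eta(r))$, and the projection $\pi_\eta(w)$ is the point of $\eta$ with $d_{\mathbb{D}}(w,\pi_\eta(w))=d_{\mathbb{D}}(w,\eta)$. *)

theory Defs
  imports "HOL-Complex_Analysis.Complex_Analysis"
begin

abbreviation unit_disk :: "complex set" where
  "unit_disk \<equiv> ball 0 1"

definition disk_dist :: "complex \<Rightarrow> complex \<Rightarrow> real" where
  "disk_dist z w = artanh (cmod ((z - w) / (1 - cnj z * w)))"


subsection \<open>Semigroups in the disk\<close>

text \<open>A family is a function on all of \<^typ>\<open>real\<close>; only its values at
  parameters \<open>t \<ge> 0\<close> and at points of the disk are meaningful.\<close>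

definition disk_semigroup :: "(real \<Rightarrow> complex \<Rightarrow> complex) \<Rightarrow> bool" where
  "disk_semigroup \<phi> \<longleftrightarrow>
     (\<forall>t\<ge>0. \<phi> t holomorphic_on unit_disk \<and> \<phi> t ` unit_disk \<subseteq> unit_disk) \<and>
     (\<forall>z\<in>unit_disk. \<phi> 0 z = z) \<and>
     (\<forall>t\<ge>0. \<forall>s\<ge>0. \<forall>z\<in>unit_disk. \<phi> (t + s) z = \<phi> t (\<phi> s z)) \<and>
     (\<forall>K. compact K \<longrightarrow> K \<subseteq> unit_disk \<longrightarrow> uniform_limit K \<phi> (\<lambda>z. z) (at_right 0))"

definition disk_automorphism :: "(complex \<Rightarrow> complex) \<Rightarrow> bool" where
  "disk_automorphism f \<longleftrightarrow> f holomorphic_on unit_disk \<and> bij_betw f unit_disk unit_disk"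

definition disk_group :: "(real \<Rightarrow> complex \<Rightarrow> complex) \<Rightarrow> bool" where
  "disk_group \<phi> \<longleftrightarrow> disk_semigroup \<phi> \<and> (\<exists>t>0. disk_automorphism (\<phi> t))"

definition denjoy_wolff_point :: "(real \<Rightarrow> complex \<Rightarrow> complex) \<Rightarrow> complex \<Rightarrow> bool" where
  "denjoy_wolff_point \<phi> \<tau> \<longleftrightarrow>
     \<tau> \<in> cball 0 1 \<and> (\<forall>z\<in>unit_disk. ((\<lambda>t. \<phi> t z) \<longlongrightarrow> \<tau>) at_top)"

definition elliptic :: "(real \<Rightarrow> complex \<Rightarrow> complex) \<Rightarrow> bool" where
  "elliptic \<phi> \<longleftrightarrow> \<not> disk_group \<phi> \<and> (\<exists>\<tau>\<in>unit_disk. denjoy_wolff_point \<phi> \<tau>)"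

definition non_elliptic :: "(real \<Rightarrow> complex \<Rightarrow> complex) \<Rightarrow> bool" where
  "non_elliptic \<phi> \<longleftrightarrow> \<not> disk_group \<phi> \<and> (\<exists>\<tau>\<in>sphere 0 1. denjoy_wolff_point \<phi> \<tau>)"


subsection \<open>Boundary fixed points\<close>

definition stolz_region :: "complex \<Rightarrow> real \<Rightarrow> complex set" where
  "stolz_region \<sigma> M = {z \<in> unit_disk. cmod (\<sigma> - z) < M * (1 - cmod z)}"

definition angular_limit :: "(complex \<Rightarrow> complex) \<Rightarrow> complex \<Rightarrow> complex \<Rightarrow> bool" where
  "angular_limit f \<sigma> l \<longleftrightarrow> (\<forall>M>1. (f \<longlongrightarrow> l) (at \<sigma> within stolz_region \<sigma> M))"

definition boundary_fixed_point :: "(real \<Rightarrow> complex \<Rightarrow> complex) \<Rightarrow> complex \<Rightarrow> bool" where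
  "boundary_fixed_point \<phi> \<sigma> \<longleftrightarrow> \<sigma> \<in> sphere 0 1 \<and> (\<forall>t\<ge>0. angular_limit (\<phi> t) \<sigma> \<sigma>)"

text \<open>The angular derivative at a boundary fixed point \<open>\<sigma>\<close> is the angular limit of
  the difference quotient with \<open>\<sigma>\<close> itself as the boundary value; being finite means that
  this limit exists in the complex plane.\<close>

definition regular_fixed_point :: "(real \<Rightarrow> complex \<Rightarrow> complex) \<Rightarrow> complex \<Rightarrow> bool" where
  "regular_fixed_point \<phi> \<sigma> \<longleftrightarrow> boundary_fixed_point \<phi> \<sigma> \<and>
     (\<forall>t\<ge>0. \<exists>L. angular_limit (\<lambda>z. (\<phi> t z - \<sigma>) / (z - \<sigma>)) \<sigma> L)"

definition repelling_fixed_point :: "(real \<Rightarrow> complex \<Rightarrow> complex) \<Rightarrow> complex \<Rightarrow> bool" where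
  "repelling_fixed_point \<phi> \<sigma> \<longleftrightarrow> regular_fixed_point \<phi> \<sigma> \<and> \<not> denjoy_wolff_point \<phi> \<sigma>"


subsection \<open>Petals and backward orbits\<close>

definition backward_invariant_set :: "(real \<Rightarrow> complex \<Rightarrow> complex) \<Rightarrow> complex set" where
  "backward_invariant_set \<phi> = (\<Inter>t\<in>{0..}. \<phi> t ` unit_disk)"

definition petal :: "(real \<Rightarrow> complex \<Rightarrow> complex) \<Rightarrow> complex set \<Rightarrow> bool" where
  "petal \<phi> \<Delta> \<longleftrightarrow> \<Delta> \<in> components (interior (backward_invariant_set \<phi>))"

text \<open>For \<open>t \<le> 0\<close>, the value at \<open>t\<close> is the point usually written \<open>\<phi>\<^sub>t(z)\<close>.\<close>

definition backward_orbit ::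
    "(real \<Rightarrow> complex \<Rightarrow> complex) \<Rightarrow> complex set \<Rightarrow> complex \<Rightarrow> real \<Rightarrow> complex" where
  "backward_orbit \<phi> \<Delta> z t = inv_into \<Delta> (\<phi> (- t)) z"

definition koenigs_function ::
    "(real \<Rightarrow> complex \<Rightarrow> complex) \<Rightarrow> (complex \<Rightarrow> complex) \<Rightarrow> bool" where
  "koenigs_function \<phi> h \<longleftrightarrow>
     h holomorphic_on unit_disk \<and> inj_on h unit_disk \<and> h 0 = 0 \<and>
     (\<forall>t\<ge>0. \<forall>z\<in>unit_disk. h (\<phi> t z) = h z + of_real t)"

definition horizontal_strip :: "complex set \<Rightarrow> bool" where
  "horizontal_strip S \<longleftrightarrow> (\<exists>a b. a < b \<and> S = {w. a < Im w \<and> Im w < b})"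

definition horizontal_half_plane :: "complex set \<Rightarrow> bool" where
  "horizontal_half_plane H \<longleftrightarrow> (\<exists>a. H = {w. a < Im w} \<or> H = {w. Im w < a})"

definition maximal_in ::
    "(complex set \<Rightarrow> bool) \<Rightarrow> complex set \<Rightarrow> complex set \<Rightarrow> bool" where
  "maximal_in P \<Omega> S \<longleftrightarrow>
     P S \<and> S \<subseteq> \<Omega> \<and> (\<forall>S'. P S' \<and> S \<subseteq> S' \<and> S' \<subseteq> \<Omega> \<longrightarrow> S' = S)"

definition hyperbolic_petal :: "(real \<Rightarrow> complex \<Rightarrow> complex) \<Rightarrow> complex set \<Rightarrow> bool" where
  "hyperbolic_petal \<phi> \<Delta> \<longleftrightarrow> petal \<phi> \<Delta> \<and>
     (elliptic \<phi> \<or>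
      non_elliptic \<phi> \<and>
        (\<exists>h. koenigs_function \<phi> h \<and> maximal_in horizontal_strip (h ` unit_disk) (h ` \<Delta>)))"

definition parabolic_petal :: "(real \<Rightarrow> complex \<Rightarrow> complex) \<Rightarrow> complex set \<Rightarrow> bool" where
  "parabolic_petal \<phi> \<Delta> \<longleftrightarrow> petal \<phi> \<Delta> \<and> non_elliptic \<phi> \<and>
     (\<exists>h. koenigs_function \<phi> h \<and> maximal_in horizontal_half_plane (h ` unit_disk) (h ` \<Delta>))"


subsection \<open>Geodesics and speeds\<close>

text \<open>A full geodesic is an injective curve along which the hyperbolic distance is additive
  and which has infinite length in both directions. No particular parametrization of the
  interval is imposed.\<close>

definition full_geodesic :: "(real \<Rightarrow> complex) \<Rightarrow> bool" where
  "full_geodesic \<eta> \<longleftrightarrow>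
     continuous_on {-1<..<1} \<eta> \<and> inj_on \<eta> {-1<..<1} \<and> \<eta> ` {-1<..<1} \<subseteq> unit_disk \<and>
     (\<forall>r s u. -1 < r \<and> r \<le> s \<and> s \<le> u \<and> u < 1 \<longrightarrow>
        disk_dist (\<eta> r) (\<eta> u) = disk_dist (\<eta> r) (\<eta> s) + disk_dist (\<eta> s) (\<eta> u)) \<and>
     filterlim (\<lambda>r. disk_dist (\<eta> 0) (\<eta> r)) at_top (at_left 1) \<and>
     filterlim (\<lambda>r. disk_dist (\<eta> 0) (\<eta> r)) at_top (at_right (-1))"

text \<open>In a hyperbolic petal the endpoint is the repelling fixed point to which all
  backward orbits of the petal converge.\<close>

definition petal_geodesic ::
    "(real \<Rightarrow> complex \<Rightarrow> complex) \<Rightarrow> complex set \<Rightarrow> complex \<Rightarrow> (real \<Rightarrow> complex) \<Rightarrow> bool" where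
  "petal_geodesic \<phi> \<Delta> z \<eta> \<longleftrightarrow> full_geodesic \<eta> \<and> \<eta> 0 = z \<and>
     (hyperbolic_petal \<phi> \<Delta> \<and>
        (\<exists>\<sigma>. repelling_fixed_point \<phi> \<sigma> \<and>
             (\<forall>w\<in>\<Delta>. (backward_orbit \<phi> \<Delta> w \<longlongrightarrow> \<sigma>) at_bot) \<and>
             (\<eta> \<longlongrightarrow> \<sigma>) (at_left 1)) \<or>
      parabolic_petal \<phi> \<Delta> \<and>
        (\<exists>\<tau>. denjoy_wolff_point \<phi> \<tau> \<and> (\<eta> \<longlongrightarrow> \<tau>) (at_left 1)))"

definition dist_to_curve :: "complex \<Rightarrow> (real \<Rightarrow> complex) \<Rightarrow> real" where
  "dist_to_curve w \<eta> = (INF r\<in>{-1<..<1}. disk_dist w (\<eta> r))"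

definition curve_projection :: "(real \<Rightarrow> complex) \<Rightarrow> complex \<Rightarrow> complex" where
  "curve_projection \<eta> w = (THE p. p \<in> \<eta> ` {-1<..<1} \<and> disk_dist w p = dist_to_curve w \<eta>)"

definition total_speed ::
    "(real \<Rightarrow> complex \<Rightarrow> complex) \<Rightarrow> complex set \<Rightarrow> complex \<Rightarrow> real \<Rightarrow> real" where
  "total_speed \<phi> \<Delta> z t = disk_dist z (backward_orbit \<phi> \<Delta> z t)"

definition orthogonal_speed ::
    "(real \<Rightarrow> complex \<Rightarrow> complex) \<Rightarrow> complex set \<Rightarrow> complex \<Rightarrow> (real \<Rightarrow> complex) \<Rightarrow> real \<Rightarrow> real"
  where
  "orthogonal_speed \<phi> \<Delta> z \<eta> t =
     disk_dist z (curve_projection \<eta> (backward_orbit \<phi> \<Delta> z t))"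

definition tangential_speed ::
    "(real \<Rightarrow> complex \<Rightarrow> complex) \<Rightarrow> complex set \<Rightarrow> complex \<Rightarrow> (real \<Rightarrow> complex) \<Rightarrow> real \<Rightarrow> real"
  where
  "tangential_speed \<phi> \<Delta> z \<eta> t = dist_to_curve (backward_orbit \<phi> \<Delta> z t) \<eta>"

end

theory Submission
  imports Defs
begin

text \<open>
The estimate is one about right-angled hyperbolic triangles; the semigroup enters only through the fact
that the backward orbit of \<open>z\<close> stays in the disk. Let \<open>w = \<phi>\<^sub>t(z)\<close> with \<open>t \<le> 0\<close>, and let \<open>p\<close> be the
projection of \<open>w\<close> to the geodesic \<open>\<eta>\<close>. The points \<open>z\<close>, \<open>p\<close> and \<open>w\<close> form a triangle with a right angle at
\<open>p\<close>, whose legs have lengths \<open>a = v\<^sup>o(t)\<close> and \<open>b = v\<^sup>T(t)\<close> and whose hypotenuse has length \<open>c = v(t)\<close>. For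
the metric \<open>artanh |(z - w) / (1 - cnj z * w)|\<close>, of curvature \<open>-4\<close>, the Pythagorean theorem says
\<open>cosh (2 * c) = cosh (2 * a) * cosh (2 * b)\<close> (\<open>geodesic_projection\<close>). Elementary estimates of the
hyperbolic cosine then give \<open>a + b - (ln 2) / 2 \<le> c \<le> a + b\<close> (\<open>hyperbolic_hypotenuse_bounds\<close>).

As a geodesic is given as an arbitrary curve of infinite length in both directions along which distances
add up, the right-angled triangle comes from \<open>full_geodesic_straighten\<close>: a Moebius isometry maps such a
curve onto the real diameter, where the projection can be computed (\<open>diameter_projection\<close>).

That the backward orbit is well defined rests on \<open>\<Delta> \<subseteq> \<phi>\<^sub>s(\<Delta>)\<close> for \<open>s \<ge> 0\<close> (\<open>petal_subset_image\<close>). This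
uses that the maps of a semigroup are injective (\<open>disk_semigroup_inj_on\<close>) and that orbits are continuous
in time (\<open>disk_semigroup_orbit_continuous\<close>), so that an orbit segment cannot leave a component of the
interior of the backward invariant set.
\<close>

section \<open>Injectivity and continuity of semigroups\<close>

text \<open>Cauchy's estimate on circles of radius \<open>r\<close> bounds the derivative on the smaller ball. The estimate
serves twice: with \<open>B = 1\<close> it makes all maps of a semigroup equicontinuous, and with small \<open>B\<close> it
shows that a holomorphic map uniformly close to the identity is injective.\<close>

lemma holomorphic_bounded_imp_Lipschitz:
  fixes f :: "complex \<Rightarrow> complex"
  assumes holf: "f holomorphic_on ball p (2 * r)" and "r > 0"
    and bound: "\<And>x. x \<in> ball p (2 * r) \<Longrightarrow> cmod (f x) \<le> B"
    and "x \<in> ball p r" and "y \<in> ball p r"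
  shows "cmod (f x - f y) \<le> B / r * cmod (x - y)"
proof (rule field_differentiable_bound[OF convex_ball _ _ assms(4,5)])
  fix u assume u: "u \<in> ball p r"
  have sub: "cball u r \<subseteq> ball p (2 * r)"
  proof
    fix v assume "v \<in> cball u r"
    then show "v \<in> ball p (2 * r)"
      using u dist_triangle[of p v u] by (simp add: dist_commute)
  qed
  have holu: "f holomorphic_on cball u r"
    using holf sub by (rule holomorphic_on_subset)
  have "cmod ((deriv ^^ 1) f u) \<le> fact 1 * B / r ^ 1"
  proof (rule Cauchy_inequality)
    show "f holomorphic_on ball u r"
      using holu by (rule holomorphic_on_subset) auto
    show "continuous_on (cball u r) f"
      using holu by (rule holomorphic_on_imp_continuous_on)
    show "cmod (f v) \<le> B" if "cmod (u - v) = r" for v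
      using that sub bound[of v] by (auto simp: dist_norm)
  qed (use \<open>r > 0\<close> in auto)
  then show "cmod (deriv f u) \<le> B / r" by simp
  have "u \<in> cball u r" using \<open>r > 0\<close> by simp
  with sub have "u \<in> ball p (2 * r)" by blast
  then show "(f has_field_derivative deriv f u) (at u within ball p r)"
    using holomorphic_derivI[OF holf open_ball] has_field_derivative_at_within by blast
qed

lemma disk_semigroup_holomorphic:
  "disk_semigroup \<phi> \<Longrightarrow> t \<ge> 0 \<Longrightarrow> \<phi> t holomorphic_on unit_disk"
  unfolding disk_semigroup_def by blast

lemma disk_semigroup_in_disk:
  "disk_semigroup \<phi> \<Longrightarrow> t \<ge> 0 \<Longrightarrow> z \<in> unit_disk \<Longrightarrow> \<phi> t z \<in> unit_disk"
  unfolding disk_semigroup_def by blast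

lemma disk_semigroup_zero:
  "disk_semigroup \<phi> \<Longrightarrow> z \<in> unit_disk \<Longrightarrow> \<phi> 0 z = z"
  unfolding disk_semigroup_def by blast

lemma disk_semigroup_add:
  "disk_semigroup \<phi> \<Longrightarrow> t \<ge> 0 \<Longrightarrow> s \<ge> 0 \<Longrightarrow> z \<in> unit_disk \<Longrightarrow> \<phi> (t + s) z = \<phi> t (\<phi> s z)"
  unfolding disk_semigroup_def by blast

lemma disk_semigroup_near_identity:
  assumes sg: "disk_semigroup \<phi>" and "compact K" "K \<subseteq> unit_disk" "e > 0"
  obtains d where "d > 0" "\<And>h x. 0 \<le> h \<Longrightarrow> h < d \<Longrightarrow> x \<in> K \<Longrightarrow> cmod (\<phi> h x - x) < e"
proof -
  have "uniform_limit K \<phi> (\<lambda>z. z) (at_right 0)"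
    using assms unfolding disk_semigroup_def by blast
  then have "\<forall>\<^sub>F h in at_right 0. \<forall>x\<in>K. dist (\<phi> h x) x < e"
    using \<open>e > 0\<close> by (rule uniform_limitD)
  then obtain d where d: "d > 0" "\<And>h. 0 < h \<Longrightarrow> h < d \<Longrightarrow> \<forall>x\<in>K. dist (\<phi> h x) x < e"
    unfolding eventually_at_right_field by auto
  have "cmod (\<phi> h x - x) < e" if "0 \<le> h" "h < d" "x \<in> K" for h x
  proof (cases "h = 0")
    case True
    then show ?thesis using disk_semigroup_zero[OF sg] that assms by auto
  next
    case False
    then show ?thesis using d(2)[of h] that by (auto simp: dist_norm)
  qed
  with d(1) show ?thesis by (rule that)
qed

text \<open>Since \<open>\<phi>\<^sub>t(z) = \<phi>\<^sub>s(\<phi>\<^sub>t\<^sub>-\<^sub>s(z))\<close> for \<open>s \<le> t\<close>, the distance between \<open>\<phi>\<^sub>s(z)\<close> and \<open>\<phi>\<^sub>t(z)\<close> is, by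
equicontinuity of the family, at most a constant times the distance between \<open>z\<close> and
\<open>\<phi>\<^sub>t\<^sub>-\<^sub>s(z)\<close>. Hence right continuity at \<open>0\<close> propagates to two-sided continuity everywhere.\<close>

lemma disk_semigroup_orbit_continuous:
  assumes sg: "disk_semigroup \<phi>" and z: "z \<in> unit_disk"
  shows "continuous_on {0..} (\<lambda>t. \<phi> t z)"
proof -
  define r where "r = (1 - cmod z) / 2"
  have r: "r > 0" using z by (simp add: r_def)
  have ball: "ball z (2 * r) \<subseteq> unit_disk"
  proof
    fix x assume "x \<in> ball z (2 * r)"
    then show "x \<in> unit_disk"
      using norm_triangle_sub[of x z] by (auto simp: dist_norm r_def norm_minus_commute)
  qed
  have shift: "cmod (\<phi> s z - \<phi> t z) \<le> 1 / r * cmod (\<phi> (t - s) z - z)"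
    if "0 \<le> s" "s \<le> t" "cmod (\<phi> (t - s) z - z) < r" for s t
  proof -
    have "\<phi> t z = \<phi> s (\<phi> (t - s) z)"
      using disk_semigroup_add[OF sg, of s "t - s" z] that z by simp
    moreover have "cmod (\<phi> s z - \<phi> s (\<phi> (t - s) z)) \<le> 1 / r * cmod (z - \<phi> (t - s) z)"
    proof (rule holomorphic_bounded_imp_Lipschitz)
      show "\<phi> s holomorphic_on ball z (2 * r)"
        using disk_semigroup_holomorphic[OF sg \<open>0 \<le> s\<close>] ball by (rule holomorphic_on_subset)
      show "cmod (\<phi> s x) \<le> 1" if "x \<in> ball z (2 * r)" for x
        using disk_semigroup_in_disk[OF sg \<open>0 \<le> s\<close>, of x] ball that by auto
    qed (use r that in \<open>auto simp: dist_norm norm_minus_commute\<close>)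
    ultimately show ?thesis by (simp add: norm_minus_commute)
  qed
  show ?thesis
    unfolding continuous_on_iff
  proof (intro ballI allI impI)
    fix t e :: real assume t: "t \<in> {0..}" and e: "e > 0"
    have "min r (e * r) > 0" using r e by simp
    then obtain d where d: "d > 0"
      "\<And>h x. 0 \<le> h \<Longrightarrow> h < d \<Longrightarrow> x \<in> {z} \<Longrightarrow> cmod (\<phi> h x - x) < min r (e * r)"
      using disk_semigroup_near_identity[OF sg, of "{z}" "min r (e * r)"] z by auto
    have close: "cmod (\<phi> s z - \<phi> u z) < e" if "0 \<le> s" "s \<le> u" "u - s < d" for s u
    proof -
      have lt: "cmod (\<phi> (u - s) z - z) < min r (e * r)" using d(2)[of "u - s" z] that by simp
      then have "cmod (\<phi> s z - \<phi> u z) \<le> 1 / r * cmod (\<phi> (u - s) z - z)"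
        using shift that by simp
      also have "\<dots> < e" using lt r by (simp add: field_simps)
      finally show ?thesis .
    qed
    show "\<exists>d>0. \<forall>s\<in>{0..}. dist s t < d \<longrightarrow> dist (\<phi> s z) (\<phi> t z) < e"
    proof (intro exI[of _ d] conjI ballI impI)
      fix s assume "s \<in> {0..}" "dist s t < d"
      then show "dist (\<phi> s z) (\<phi> t z) < e"
        using close[of s t] close[of t s] t
        by (cases "s \<le> t") (auto simp: dist_norm norm_minus_commute)
    qed (rule d(1))
  qed
qed

text \<open>If two orbits meet, consider the first time \<open>u\<close> at which they do, and suppose \<open>u > 0\<close>. Just before \<open>u\<close>
they are at distinct points near the meeting point \<open>p\<close>, and these are identified by \<open>\<phi>\<^sub>h\<close> for some
small \<open>h\<close>. But \<open>\<phi>\<^sub>h\<close> is uniformly close to the identity near \<open>p\<close>, hence injective there. So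
\<open>u = 0\<close>, and the two starting points coincide.\<close>

lemma disk_semigroup_inj_on:
  assumes sg: "disk_semigroup \<phi>" and "s \<ge> 0"
  shows "inj_on (\<phi> s) unit_disk"
proof (rule inj_onI)
  fix a b assume a: "a \<in> unit_disk" and b: "b \<in> unit_disk" and eq: "\<phi> s a = \<phi> s b"
  define T where "T = {t \<in> {0..}. \<phi> t a - \<phi> t b = 0}"
  have cont: "continuous_on {0..} (\<lambda>t. \<phi> t a)" "continuous_on {0..} (\<lambda>t. \<phi> t b)"
    using disk_semigroup_orbit_continuous[OF sg] a b by auto
  have "closed T"
    unfolding T_def
    by (intro continuous_closed_preimage_constant continuous_intros cont)
  moreover have "s \<in> T" using \<open>s \<ge> 0\<close> eq by (simp add: T_def)
  moreover have bdd: "bdd_below T" by (rule bdd_belowI[of _ 0]) (auto simp: T_def)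
  ultimately have "Inf T \<in> T"
    by (intro closed_contains_Inf) auto
  define u where "u = Inf T"
  have u: "u \<ge> 0" "\<phi> u a = \<phi> u b" using \<open>Inf T \<in> T\<close> by (auto simp: T_def u_def)
  have "u = 0"
  proof (rule ccontr)
    assume "u \<noteq> 0"
    define p where "p = \<phi> u a"
    have p: "p \<in> unit_disk" using disk_semigroup_in_disk[OF sg u(1) a] by (simp add: p_def)
    \<comment> \<open>a third, so that even the closed ball of radius \<open>2 * r\<close> about \<open>p\<close> lies in the disk\<close>
    define r where "r = (1 - cmod p) / 3"
    have r: "r > 0" using p by (simp add: r_def)
    have sub: "cball p (2 * r) \<subseteq> unit_disk"
    proof
      fix x assume x: "x \<in> cball p (2 * r)"
      have "2 * r < 1 - cmod p" using r by (simp add: r_def)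
      then show "x \<in> unit_disk"
        using x norm_triangle_sub[of x p] by (auto simp: dist_norm norm_minus_commute)
    qed
    obtain d where d: "d > 0"
      "\<And>h x. 0 \<le> h \<Longrightarrow> h < d \<Longrightarrow> x \<in> cball p (2 * r) \<Longrightarrow> cmod (\<phi> h x - x) < r / 2"
      using disk_semigroup_near_identity[OF sg compact_cball sub, of "r / 2"] r by auto
    obtain da where da: "da > 0" "\<And>t. t \<ge> 0 \<Longrightarrow> dist t u < da \<Longrightarrow> dist (\<phi> t a) p < r"
      using cont(1) u r unfolding continuous_on_iff p_def by (metis atLeast_iff)
    obtain db where db: "db > 0" "\<And>t. t \<ge> 0 \<Longrightarrow> dist t u < db \<Longrightarrow> dist (\<phi> t b) p < r"
      using cont(2) u r unfolding continuous_on_iff p_def by (metis atLeast_iff)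
    define h where "h = min (min d u) (min da db) / 2"
    have h: "h > 0" "h < d" "h < u" "h < da" "h < db"
      using d(1) da(1) db(1) u(1) \<open>u \<noteq> 0\<close> by (auto simp: h_def)
    define x where "x = \<phi> (u - h) a"
    define y where "y = \<phi> (u - h) b"
    have x: "x \<in> ball p r" using da(2)[of "u - h"] h by (simp add: x_def dist_commute dist_norm)
    have y: "y \<in> ball p r" using db(2)[of "u - h"] h by (simp add: y_def dist_commute dist_norm)
    have "\<phi> h x = p" "\<phi> h y = p"
      using disk_semigroup_add[OF sg, of h "u - h"] a b u h by (auto simp: x_def y_def p_def)
    then have "cmod (x - y) = cmod ((\<phi> h x - x) - (\<phi> h y - y))"
      by (simp add: norm_minus_commute)
    \<comment> \<open>\<open>\<phi>\<^sub>h - id\<close> is a contraction near \<open>p\<close>, with constant \<open>1/2\<close>\<close>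
    also have "\<dots> \<le> (r / 2) / r * cmod (x - y)"
    proof (rule holomorphic_bounded_imp_Lipschitz[of "\<lambda>v. \<phi> h v - v", OF _ r _ x y])
      show "(\<lambda>v. \<phi> h v - v) holomorphic_on ball p (2 * r)"
        using disk_semigroup_holomorphic[OF sg, of h] h sub
        by (intro holomorphic_intros) (auto elim!: holomorphic_on_subset)
      show "cmod (\<phi> h v - v) \<le> r / 2" if "v \<in> ball p (2 * r)" for v
        using d(2)[of h v] h that by auto
    qed
    finally have "x = y" using r by simp
    then have "u - h \<in> T" using h by (simp add: T_def x_def y_def)
    then have "u \<le> u - h" unfolding u_def using bdd by (rule cInf_lower)
    then show False using h by simp
  qed
  then show "a = b" using u disk_semigroup_zero[OF sg] a b by simp
qed

section \<open>Backward invariance of petals\<close>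

lemma backward_invariant_set_subset_disk:
  assumes "disk_semigroup \<phi>"
  shows "backward_invariant_set \<phi> \<subseteq> unit_disk"
  using assms disk_semigroup_in_disk[of \<phi> 0] by (force simp: backward_invariant_set_def)

text \<open>A point of \<open>\<phi>\<^sub>s(D) \<inter> W\<close> is \<open>\<phi>\<^sub>s\<^sub>+\<^sub>t(v) = \<phi>\<^sub>s(\<phi>\<^sub>t(v))\<close> for every \<open>t\<close>, with a suitable \<open>v\<close>; as \<open>\<phi>\<^sub>s\<close> is
injective, its only preimage is \<open>\<phi>\<^sub>t(v)\<close>. Conversely, \<open>\<phi>\<^sub>s\<close> maps the image of \<open>\<phi>\<^sub>t\<close> into itself because
the two maps commute.\<close>

lemma backward_invariant_set_iff:
  assumes sg: "disk_semigroup \<phi>" and s: "s \<ge> 0" and u: "u \<in> unit_disk"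
  shows "\<phi> s u \<in> backward_invariant_set \<phi> \<longleftrightarrow> u \<in> backward_invariant_set \<phi>"
proof
  assume W: "\<phi> s u \<in> backward_invariant_set \<phi>"
  have "u \<in> \<phi> t ` unit_disk" if t: "t \<ge> 0" for t
  proof -
    obtain v where v: "v \<in> unit_disk" "\<phi> s u = \<phi> (s + t) v"
      using W s t unfolding backward_invariant_set_def by force
    then have "\<phi> s u = \<phi> s (\<phi> t v)" using disk_semigroup_add[OF sg s t] by simp
    then have "u = \<phi> t v"
      using disk_semigroup_inj_on[OF sg s] u disk_semigroup_in_disk[OF sg t v(1)]
      by (auto dest: inj_onD)
    then show ?thesis using v by blast
  qed
  then show "u \<in> backward_invariant_set \<phi>" by (auto simp: backward_invariant_set_def)
next
  assume W: "u \<in> backward_invariant_set \<phi>"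
  have "\<phi> s u \<in> \<phi> t ` unit_disk" if t: "t \<ge> 0" for t
  proof -
    obtain v where v: "v \<in> unit_disk" "u = \<phi> t v"
      using W t unfolding backward_invariant_set_def by force
    then have "\<phi> s u = \<phi> t (\<phi> s v)"
      using disk_semigroup_add[OF sg s t v(1)] disk_semigroup_add[OF sg t s v(1)]
      by (simp add: add.commute)
    then show ?thesis using v disk_semigroup_in_disk[OF sg s] by blast
  qed
  then show "\<phi> s u \<in> backward_invariant_set \<phi>" by (auto simp: backward_invariant_set_def)
qed

text \<open>Being injective and holomorphic, \<open>\<phi>\<^sub>s\<close> is continuous and open, so the equivalence passes from the
backward invariant set to its interior.\<close>

lemma interior_backward_invariant_set_iff:
  assumes sg: "disk_semigroup \<phi>" and s: "s \<ge> 0" and u: "u \<in> unit_disk"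
  shows "\<phi> s u \<in> interior (backward_invariant_set \<phi>) \<longleftrightarrow>
         u \<in> interior (backward_invariant_set \<phi>)"
proof
  let ?W = "backward_invariant_set \<phi>"
  assume "\<phi> s u \<in> interior ?W"
  moreover have "open (unit_disk \<inter> \<phi> s -` interior ?W)"
    using disk_semigroup_holomorphic[OF sg s] holomorphic_on_imp_continuous_on
    by (intro continuous_open_preimage) auto
  moreover have "unit_disk \<inter> \<phi> s -` interior ?W \<subseteq> ?W"
    using backward_invariant_set_iff[OF sg s] interior_subset by blast
  ultimately show "u \<in> interior ?W" using u by (auto intro: interiorI)
next
  let ?W = "backward_invariant_set \<phi>"
  assume uW: "u \<in> interior ?W"
  have sub: "interior ?W \<subseteq> unit_disk"
    using backward_invariant_set_subset_disk[OF sg] interior_subset by blast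
  have "open (\<phi> s ` interior ?W)"
  proof (rule open_mapping_thm3)
    show "\<phi> s holomorphic_on interior ?W"
      using disk_semigroup_holomorphic[OF sg s] sub by (rule holomorphic_on_subset)
    show "inj_on (\<phi> s) (interior ?W)"
      using disk_semigroup_inj_on[OF sg s] sub by (rule inj_on_subset)
  qed auto
  moreover have "\<phi> s ` interior ?W \<subseteq> ?W"
    using backward_invariant_set_iff[OF sg s] sub interior_subset by blast
  ultimately show "\<phi> s u \<in> interior ?W" using uW by (auto intro: interiorI)
qed

text \<open>A preimage \<open>u\<close> of a point \<open>z\<close> of the petal lies in the interior of the backward invariant set, and the
orbit segment from \<open>u\<close> to \<open>z = \<phi>\<^sub>s(u)\<close> is a connected subset of that interior. So \<open>u\<close> is in the same
component as \<open>z\<close>.\<close>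

lemma petal_subset_image:
  assumes sg: "disk_semigroup \<phi>" and petal: "petal \<phi> \<Delta>" and s: "s \<ge> 0"
  shows "\<Delta> \<subseteq> \<phi> s ` \<Delta>"
proof
  let ?I = "interior (backward_invariant_set \<phi>)"
  have comp: "\<Delta> \<in> components ?I" using petal by (simp add: petal_def)
  fix z assume z: "z \<in> \<Delta>"
  then have zI: "z \<in> ?I" using in_components_subset[OF comp] by blast
  then have "z \<in> backward_invariant_set \<phi>" using interior_subset by blast
  then obtain u where u: "u \<in> unit_disk" "z = \<phi> s u"
    using s unfolding backward_invariant_set_def by force
  have uI: "u \<in> ?I"
    using interior_backward_invariant_set_iff[OF sg s u(1)] zI u(2) by simp
  define C where "C = (\<lambda>t. \<phi> t u) ` {0..s}"
  have "connected C"
    unfolding C_def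
    by (intro connected_continuous_image continuous_on_subset[OF disk_semigroup_orbit_continuous[OF sg u(1)]])
       auto
  moreover have "C \<subseteq> ?I"
    using interior_backward_invariant_set_iff[OF sg _ u(1)] uI by (auto simp: C_def)
  moreover have "z \<in> C" using u s by (auto simp: C_def)
  ultimately have "C \<subseteq> \<Delta>"
    using components_maximal[OF comp, of C] z by blast
  moreover have "u \<in> C"
    using disk_semigroup_zero[OF sg u(1)] s by (auto simp: C_def image_iff intro!: bexI[of _ 0])
  ultimately show "z \<in> \<phi> s ` \<Delta>" using u by blast
qed

lemma petal_subset_disk:
  assumes "disk_semigroup \<phi>" and "petal \<phi> \<Delta>"
  shows "\<Delta> \<subseteq> unit_disk"
  using assms backward_invariant_set_subset_disk[of \<phi>] in_components_subset interior_subset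
  unfolding petal_def by blast

text \<open>The backward orbit is defined through \<^const>\<open>inv_into\<close>, whose value is arbitrary outside the image;
surjectivity of \<open>\<phi>\<^sub>-\<^sub>t\<close> on the petal is what makes it meaningful.\<close>

lemma backward_orbit_in_petal:
  assumes "disk_semigroup \<phi>" and "petal \<phi> \<Delta>" and "z \<in> \<Delta>" and "t \<le> 0"
  shows "backward_orbit \<phi> \<Delta> z t \<in> \<Delta>"
  unfolding backward_orbit_def
  using petal_subset_image[OF assms(1,2), of "- t"] assms by (intro inv_into_into) auto

section \<open>The hyperbolic distance of the disk\<close>

lemma one_minus_cmod_power2_pos:
  "z \<in> unit_disk \<Longrightarrow> 0 < 1 - (cmod z)\<^sup>2"
  by (simp add: power_less_one_iff abs_square_less_1)

lemma cmod_one_minus_cnj_mult_power2: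
  "(cmod (1 - cnj z * w))\<^sup>2 = (cmod (z - w))\<^sup>2 + (1 - (cmod z)\<^sup>2) * (1 - (cmod w)\<^sup>2)"
  unfolding cmod_power2 by (simp add: algebra_simps power2_eq_square)

lemma one_minus_cnj_mult_nonzero:
  assumes "z \<in> unit_disk" "w \<in> unit_disk"
  shows "1 - cnj z * w \<noteq> 0"
proof -
  have "0 < (1 - (cmod z)\<^sup>2) * (1 - (cmod w)\<^sup>2)"
    using assms one_minus_cmod_power2_pos by simp
  then have "(cmod (1 - cnj z * w))\<^sup>2 > 0"
    unfolding cmod_one_minus_cnj_mult_power2 by (simp add: add_nonneg_pos)
  then show ?thesis by auto
qed

lemma cosh_double_artanh:
  fixes q :: real
  assumes "0 \<le> q" "q < 1"
  shows "cosh (2 * artanh q) = (1 + q\<^sup>2) / (1 - q\<^sup>2)"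
    and "sinh (2 * artanh q) = 2 * q / (1 - q\<^sup>2)"
proof -
  have e: "exp (2 * artanh q) = (1 + q) / (1 - q)"
    using assms by (simp add: artanh_def)
  have nz: "1 + q \<noteq> 0" "1 - q \<noteq> 0" "1 - q\<^sup>2 \<noteq> 0"
    using assms by (auto simp: power2_eq_1_iff)
  have e': "exp (- (2 * artanh q)) = (1 - q) / (1 + q)"
    unfolding exp_minus e by simp
  have *: "1 - q\<^sup>2 = (1 - q) * (1 + q)" by (simp add: algebra_simps power2_eq_square)
  show "cosh (2 * artanh q) = (1 + q\<^sup>2) / (1 - q\<^sup>2)"
    unfolding cosh_field_def e e' * using nz
    by (simp add: divide_simps) (simp add: algebra_simps power2_eq_square)
  show "sinh (2 * artanh q) = 2 * q / (1 - q\<^sup>2)"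
    unfolding sinh_field_def e e' * using nz
    by (simp add: divide_simps) (simp add: algebra_simps power2_eq_square)
qed

lemma pseudohyperbolic_less_1:
  assumes "z \<in> unit_disk" "w \<in> unit_disk"
  shows "cmod ((z - w) / (1 - cnj z * w)) < 1"
  using Moebius_function_norm_lt_1[of z w 0] assms
  by (simp add: Moebius_function_simple norm_divide norm_minus_commute)

lemma disk_dist_nonneg:
  assumes "z \<in> unit_disk" "w \<in> unit_disk"
  shows "0 \<le> disk_dist z w"
  unfolding disk_dist_def artanh_def
  using pseudohyperbolic_less_1[OF assms] norm_ge_zero[of "(z - w) / (1 - cnj z * w)"]
  by (auto intro!: ln_ge_zero simp: le_divide_eq)

text \<open>The hyperbolic cosine of twice the distance is rational in the coordinates; for this reason the
geometry below is done with \<open>cosh (2 * d)\<close> in place of \<open>d\<close>.\<close>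

lemma cosh_disk_dist:
  assumes "z \<in> unit_disk" "w \<in> unit_disk"
  shows "cosh (2 * disk_dist z w) =
    1 + 2 * (cmod (z - w))\<^sup>2 / ((1 - (cmod z)\<^sup>2) * (1 - (cmod w)\<^sup>2))"
proof -
  define N where "N = (cmod (z - w))\<^sup>2"
  define P where "P = (1 - (cmod z)\<^sup>2) * (1 - (cmod w)\<^sup>2)"
  have P: "P > 0" and N: "N \<ge> 0"
    using assms one_minus_cmod_power2_pos by (simp_all add: P_def N_def)
  have "(cmod ((z - w) / (1 - cnj z * w)))\<^sup>2 = N / (N + P)"
    unfolding norm_divide power_divide cmod_one_minus_cnj_mult_power2 N_def P_def ..
  then have "cosh (2 * disk_dist z w) = (1 + N / (N + P)) / (1 - N / (N + P))"
    using cosh_double_artanh(1)[OF norm_ge_zero pseudohyperbolic_less_1[OF assms]]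
    by (simp add: disk_dist_def)
  also have "\<dots> = 1 + 2 * N / P"
    using P N by (simp add: divide_simps)
  finally show ?thesis by (simp add: N_def P_def)
qed

lemma disk_dist_le_iff:
  assumes "a \<in> unit_disk" "b \<in> unit_disk" "c \<in> unit_disk" "d \<in> unit_disk"
  shows "disk_dist a b \<le> disk_dist c d \<longleftrightarrow> cosh (2 * disk_dist a b) \<le> cosh (2 * disk_dist c d)"
  using cosh_real_nonneg_le_iff[of "2 * disk_dist a b" "2 * disk_dist c d"]
    disk_dist_nonneg assms by simp

lemma disk_dist_eq_0_imp_eq:
  assumes "a \<in> unit_disk" "b \<in> unit_disk" "disk_dist a b = 0"
  shows "a = b"
proof -
  have "2 * (cmod (a - b))\<^sup>2 / ((1 - (cmod a)\<^sup>2) * (1 - (cmod b)\<^sup>2)) = 0"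
    using cosh_disk_dist[OF assms(1,2)] assms(3) by simp
  moreover have "1 - (cmod a)\<^sup>2 > 0" "1 - (cmod b)\<^sup>2 > 0"
    using assms one_minus_cmod_power2_pos by auto
  ultimately show ?thesis by simp
qed

lemma disk_dist_commute: "disk_dist a b = disk_dist b a"
proof -
  have "cmod (1 - cnj a * b) = cmod (1 - cnj b * a)"
    by (metis complex_cnj_cnj complex_cnj_diff complex_cnj_mult complex_cnj_one
        complex_mod_cnj mult.commute)
  then show ?thesis by (simp add: disk_dist_def norm_divide norm_minus_commute)
qed

text \<open>The hyperbolic law of cosines for the triangle with vertices \<open>0\<close>, \<open>a\<close>, \<open>b\<close>: writing
\<open>A = 2 * disk_dist 0 a\<close> and \<open>B = 2 * disk_dist 0 b\<close>, the right-hand side is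
\<open>cosh A * cosh B - sinh A * sinh B * cos \<theta>\<close>, where \<open>\<theta>\<close> is the angle at \<open>0\<close>.\<close>

lemma cosh_law_of_cosines_disk:
  assumes "a \<in> unit_disk" "b \<in> unit_disk"
  shows "cosh (2 * disk_dist a b) =
    ((1 + (cmod a)\<^sup>2) * (1 + (cmod b)\<^sup>2) - 4 * (a \<bullet> b)) / ((1 - (cmod a)\<^sup>2) * (1 - (cmod b)\<^sup>2))"
proof -
  have "(cmod (a - b))\<^sup>2 = (cmod a)\<^sup>2 + (cmod b)\<^sup>2 - 2 * (a \<bullet> b)"
    by (simp add: power2_norm_eq_inner inner_diff inner_commute)
  moreover have "1 - (cmod a)\<^sup>2 > 0" "1 - (cmod b)\<^sup>2 > 0"
    using assms one_minus_cmod_power2_pos by auto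
  ultimately show ?thesis
    unfolding cosh_disk_dist[OF assms] by (simp add: divide_simps) (simp add: algebra_simps)
qed

lemma disk_dist_0: "disk_dist 0 a = artanh (cmod a)"
  by (simp add: disk_dist_def)

text \<open>Equality in the triangle inequality forces the angle at \<open>0\<close> in the law of cosines to be \<open>0\<close> when
\<open>a\<close> lies between \<open>0\<close> and \<open>b\<close>, and \<open>\<pi>\<close> when \<open>0\<close> lies between \<open>a\<close> and \<open>b\<close>. If \<open>a\<close> or \<open>b\<close> is \<open>0\<close>, both sides vanish.\<close>

lemma inner_of_additive:
  assumes "a \<in> unit_disk" "b \<in> unit_disk"
  shows "disk_dist 0 b = disk_dist 0 a + disk_dist a b \<Longrightarrow> a \<bullet> b = cmod a * cmod b"
    and "disk_dist a b = disk_dist a 0 + disk_dist 0 b \<Longrightarrow> a \<bullet> b = - (cmod a * cmod b)"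
proof -
  define A where "A = 2 * artanh (cmod a)"
  define B where "B = 2 * artanh (cmod b)"
  have pos: "1 - (cmod a)\<^sup>2 > 0" "1 - (cmod b)\<^sup>2 > 0"
    using assms one_minus_cmod_power2_pos by auto
  have prod: "cosh A * cosh B = (1 + (cmod a)\<^sup>2) * (1 + (cmod b)\<^sup>2) / ((1 - (cmod a)\<^sup>2) * (1 - (cmod b)\<^sup>2))"
    "sinh A * sinh B = 4 * (cmod a * cmod b) / ((1 - (cmod a)\<^sup>2) * (1 - (cmod b)\<^sup>2))"
    using assms by (simp_all add: A_def B_def cosh_double_artanh)
  {
    assume "disk_dist 0 b = disk_dist 0 a + disk_dist a b"
    then have "2 * disk_dist a b = B - A" by (simp add: disk_dist_0 A_def B_def)
    then have "cosh (2 * disk_dist a b) = cosh A * cosh B - sinh A * sinh B"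
      by (simp add: cosh_diff mult.commute)
    then show "a \<bullet> b = cmod a * cmod b"
      unfolding cosh_law_of_cosines_disk[OF assms] prod diff_divide_distrib[symmetric]
      using pos by simp
  }
  {
    assume "disk_dist a b = disk_dist a 0 + disk_dist 0 b"
    then have "2 * disk_dist a b = A + B"
      by (simp add: disk_dist_0 disk_dist_commute[of a 0] A_def B_def)
    then have "cosh (2 * disk_dist a b) = cosh A * cosh B + sinh A * sinh B"
      by (simp add: cosh_add)
    then show "a \<bullet> b = - (cmod a * cmod b)"
      unfolding cosh_law_of_cosines_disk[OF assms] prod add_divide_distrib[symmetric]
      using pos by simp
  }
qed

text \<open>Moebius maps of the disk multiply \<open>a - b\<close> and \<open>1 - cnj a * b\<close> by factors of equal modulus.\<close>

lemma disk_dist_Moebius: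
  assumes c: "c \<in> unit_disk" and a: "a \<in> unit_disk" and b: "b \<in> unit_disk"
  shows "disk_dist (Moebius_function t c a) (Moebius_function t c b) = disk_dist a b"
proof -
  define k where "k = 1 - cnj c * c"
  define E where "E = exp (\<i> * of_real t)"
  have nz: "1 - cnj c * a \<noteq> 0" "1 - cnj c * b \<noteq> 0" "1 - c * cnj a \<noteq> 0" "1 - cnj a * b \<noteq> 0" "k \<noteq> 0"
    using one_minus_cnj_mult_nonzero[OF c a] one_minus_cnj_mult_nonzero[OF c b]
      one_minus_cnj_mult_nonzero[OF a b] one_minus_cnj_mult_nonzero[OF c c]
      one_minus_cnj_mult_nonzero[OF a c] by (simp_all add: k_def mult.commute)
  have E: "cnj E * E = 1" "cmod E = 1"
    by (simp_all add: E_def exp_cnj flip: exp_add)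
  have M: "Moebius_function t c z = E * ((z - c) / (1 - cnj c * z))" for z
    by (simp add: Moebius_function_def E_def)
  have "Moebius_function t c a - Moebius_function t c b =
      E * (k * (a - b) / ((1 - cnj c * a) * (1 - cnj c * b)))"
    unfolding M k_def using nz
    by (simp add: divide_simps) (simp add: algebra_simps)
  moreover have "1 - cnj (Moebius_function t c a) * Moebius_function t c b =
      k * (1 - cnj a * b) / ((1 - c * cnj a) * (1 - cnj c * b))"
  proof -
    have "cnj (Moebius_function t c a) * Moebius_function t c b =
      (cnj E * E) * (cnj ((a - c) / (1 - cnj c * a)) * ((b - c) / (1 - cnj c * b)))"
      unfolding M by (simp add: mult.assoc mult.left_commute)
    then show ?thesis
      unfolding E k_def using nz by (simp add: divide_simps) (simp add: algebra_simps)
  qed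
  moreover have "cmod (1 - c * cnj a) = cmod (1 - cnj c * a)"
    by (metis complex_cnj_cnj complex_cnj_diff complex_cnj_mult complex_cnj_one complex_mod_cnj)
  ultimately have "cmod ((Moebius_function t c a - Moebius_function t c b) /
      (1 - cnj (Moebius_function t c a) * Moebius_function t c b)) = cmod ((a - b) / (1 - cnj a * b))"
    using nz E by (simp add: norm_divide norm_mult)
  then show ?thesis by (simp only: disk_dist_def)
qed

lemma Moebius_function_in_disk:
  "c \<in> unit_disk \<Longrightarrow> z \<in> unit_disk \<Longrightarrow> Moebius_function t c z \<in> unit_disk"
  using Moebius_function_norm_lt_1 by simp

section \<open>Projection to a geodesic\<close>

text \<open>In terms of \<open>A = 1 + |w|\<^sup>2\<close>, \<open>B = 2 * Re w\<close> and \<open>k = sqrt (A\<^sup>2 - B\<^sup>2)\<close>, completing the square shows that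
\<open>cosh (2 * disk_dist w x)\<close> is a constant \<open>k / (1 - |w|\<^sup>2)\<close> plus a nonnegative multiple of \<open>(x - x\<^sub>0)\<^sup>2\<close>
with \<open>x\<^sub>0 = B / (A + k)\<close>. So \<open>x\<^sub>0\<close> is the unique nearest point on the real diameter. Since
\<open>cosh (2 * disk_dist 0 x\<^sub>0) = A / k\<close> and \<open>cosh (2 * disk_dist 0 w) = A / (1 - |w|\<^sup>2)\<close>, the
hyperbolic Pythagorean theorem can be read off.\<close>

lemma diameter_projection:
  assumes w: "w \<in> unit_disk"
  obtains x0 :: real where "\<bar>x0\<bar> < 1"
    and "\<And>x. \<bar>x\<bar> < 1 \<Longrightarrow> disk_dist w (of_real x0) \<le> disk_dist w (of_real x)"
    and "\<And>x. \<bar>x\<bar> < 1 \<Longrightarrow> disk_dist w (of_real x) = disk_dist w (of_real x0) \<Longrightarrow> x = x0"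
    and "cosh (2 * disk_dist 0 w) =
         cosh (2 * disk_dist 0 (of_real x0)) * cosh (2 * disk_dist w (of_real x0))"
proof -
  define A where "A = 1 + (cmod w)\<^sup>2"
  define B where "B = 2 * Re w"
  define k where "k = sqrt (A\<^sup>2 - B\<^sup>2)"
  define D where "D = 1 - (cmod w)\<^sup>2"
  define x0 where "x0 = B / (A + k)"
  have D: "D > 0" using one_minus_cmod_power2_pos[OF w] by (simp add: D_def)
  have A: "A \<ge> 1" by (simp add: A_def)
  \<comment> \<open>hence \<open>A\<^sup>2 - B\<^sup>2 > 0\<close>: the square root \<open>k\<close> is genuine and positive\<close>
  have "A\<^sup>2 - B\<^sup>2 = D\<^sup>2 + (2 * Im w)\<^sup>2"
    unfolding A_def B_def D_def cmod_power2 by (simp add: power2_eq_square algebra_simps)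
  then have AB: "A\<^sup>2 - B\<^sup>2 > 0" using D by (simp add: add_pos_nonneg)
  have k: "k > 0" "k\<^sup>2 = A\<^sup>2 - B\<^sup>2" using AB by (simp_all add: k_def)
  have Ak: "A + k > 0" using A k by simp
  have B2: "B\<^sup>2 = (A + k) * (A - k)" using k(2) by (simp add: algebra_simps power2_eq_square)
  have x02: "x0\<^sup>2 = (A - k) / (A + k)"
    unfolding x0_def power_divide B2 using Ak by (simp add: power2_eq_square)
  have C0: "1 + x0\<^sup>2 = 2 * A / (A + k)" "1 - x0\<^sup>2 = 2 * k / (A + k)"
    unfolding x02 using Ak by (simp_all add: field_simps)
  have "1 - x0\<^sup>2 > 0" unfolding C0 using k Ak by simp
  then have x0: "\<bar>x0\<bar> < 1" by (simp add: abs_square_less_1)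
  have dist: "cosh (2 * disk_dist w (of_real x)) =
      k / D + (A + k) * (x - x0)\<^sup>2 / (D * (1 - x\<^sup>2))" if x: "\<bar>x\<bar> < 1" for x
  proof -
    have x1: "1 - x\<^sup>2 > 0" using x by (simp add: abs_square_less_1)
    have "(A + k) * x0 = B" using Ak by (simp add: x0_def)
    moreover have "(A + k) * x0\<^sup>2 = A - k" using Ak by (simp add: x02)
    moreover have "(A + k) * (x - x0)\<^sup>2 = (A + k) * x\<^sup>2 - 2 * ((A + k) * x0) * x + (A + k) * x0\<^sup>2"
      by (simp add: power2_eq_square algebra_simps)
    ultimately have sq: "(A + k) * (x - x0)\<^sup>2 = (A + k) * x\<^sup>2 - 2 * B * x + (A - k)" by simp
    have "cosh (2 * disk_dist w (of_real x)) = (A * (1 + x\<^sup>2) - 2 * B * x) / (D * (1 - x\<^sup>2))"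
      using cosh_law_of_cosines_disk[OF w, of "of_real x"] x
      by (simp add: A_def B_def D_def inner_complex_def)
    also have "A * (1 + x\<^sup>2) - 2 * B * x = k * (1 - x\<^sup>2) + (A + k) * (x - x0)\<^sup>2"
      unfolding sq by (simp add: algebra_simps)
    finally show ?thesis
      using D x1 by (simp add: add_divide_distrib)
  qed
  show ?thesis
  proof (rule that[OF x0])
    fix x :: real assume x: "\<bar>x\<bar> < 1"
    have x1: "1 - x\<^sup>2 > 0" using x by (simp add: abs_square_less_1)
    have nn: "(A + k) * (x - x0)\<^sup>2 / (D * (1 - x\<^sup>2)) \<ge> 0" using Ak D x1 by simp
    show "disk_dist w (of_real x0) \<le> disk_dist w (of_real x)"
      by (subst disk_dist_le_iff) (use w x x0 nn dist[OF x] dist[OF x0] in auto)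
    assume "disk_dist w (of_real x) = disk_dist w (of_real x0)"
    then have "(A + k) * (x - x0)\<^sup>2 / (D * (1 - x\<^sup>2)) = 0" using dist[OF x] dist[OF x0] by simp
    then show "x = x0" using Ak D x1 by simp
  next
    have "cosh (2 * disk_dist 0 w) = A / D"
      using cosh_law_of_cosines_disk[of 0 w] w by (simp add: A_def D_def)
    moreover have "cosh (2 * disk_dist 0 (of_real x0)) = (1 + x0\<^sup>2) / (1 - x0\<^sup>2)"
      using cosh_law_of_cosines_disk[of 0 "of_real x0"] x0 by simp
    moreover have "(1 + x0\<^sup>2) / (1 - x0\<^sup>2) = A / k"
      unfolding C0 using Ak k by simp
    ultimately show "cosh (2 * disk_dist 0 w) =
         cosh (2 * disk_dist 0 (of_real x0)) * cosh (2 * disk_dist w (of_real x0))"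
      using dist[OF x0] k by simp
  qed
qed

lemma artanh_strict_mono_imp:
  fixes x y :: real
  assumes "0 \<le> x" "x < 1" "0 \<le> y" "y < 1" "artanh x < artanh y"
  shows "x < y"
proof (rule ccontr)
  assume "\<not> x < y"
  then have "(1 + y) / (1 - y) \<le> (1 + x) / (1 - x)" using assms by (intro frac_le) auto
  then have "artanh y \<le> artanh x" unfolding artanh_def using assms by simp
  then show False using assms by simp
qed

text \<open>Move \<open>\<eta> 0\<close> to the origin. By additivity of the distance and the law of cosines, the part of the curve
with positive parameters lies on one ray from the origin, and the part with negative parameters on
the opposite ray. A rotation turns this line into the real axis. The curve then has a continuous real
coordinate, which by the infinite length in both directions comes arbitrarily near to \<open>1\<close> and
to \<open>-1\<close>; so by the intermediate value theorem it covers the whole diameter.\<close>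

lemma full_geodesic_straighten:
  assumes geo: "full_geodesic \<eta>"
  obtains t where "Moebius_function t (\<eta> 0) ` \<eta> ` {-1<..<1} = complex_of_real ` {-1<..<1}"
proof -
  have cont: "continuous_on {-1<..<1} \<eta>" and inj: "inj_on \<eta> {-1<..<1}"
    and disk: "\<And>r. -1 < r \<Longrightarrow> r < 1 \<Longrightarrow> \<eta> r \<in> unit_disk"
    and add: "\<And>r s u. -1 < r \<Longrightarrow> r \<le> s \<Longrightarrow> s \<le> u \<Longrightarrow> u < 1 \<Longrightarrow>
        disk_dist (\<eta> r) (\<eta> u) = disk_dist (\<eta> r) (\<eta> s) + disk_dist (\<eta> s) (\<eta> u)"
    and lim1: "filterlim (\<lambda>r. disk_dist (\<eta> 0) (\<eta> r)) at_top (at_left 1)"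
    and lim2: "filterlim (\<lambda>r. disk_dist (\<eta> 0) (\<eta> r)) at_top (at_right (-1))"
    using geo unfolding full_geodesic_def by (simp_all add: image_subset_iff)
  define c where "c = \<eta> 0"
  have c: "c \<in> unit_disk" using disk[of 0] by (simp add: c_def)
  define \<gamma> where "\<gamma> r = Moebius_function 0 c (\<eta> r)" for r
  have \<gamma>0: "\<gamma> 0 = 0" by (simp add: \<gamma>_def c_def Moebius_function_eq_zero)
  have \<gamma>disk: "\<gamma> r \<in> unit_disk" if "-1 < r" "r < 1" for r
    unfolding \<gamma>_def by (rule Moebius_function_in_disk[OF c disk[OF that]])
  have \<gamma>dist: "disk_dist (\<gamma> r) (\<gamma> s) = disk_dist (\<eta> r) (\<eta> s)"
    if "-1 < r" "r < 1" "-1 < s" "s < 1" for r s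
    unfolding \<gamma>_def by (rule disk_dist_Moebius[OF c disk disk]) (use that in auto)
  \<comment> \<open>any point with positive parameter determines the ray; the choice \<open>1/2\<close> is arbitrary\<close>
  define u where "u = \<gamma> (1/2)"
  have udisk: "u \<in> unit_disk" unfolding u_def by (rule \<gamma>disk) auto
  have "u \<noteq> 0"
  proof
    assume "u = 0"
    then have "disk_dist (\<eta> 0) (\<eta> (1/2)) = 0"
      using \<gamma>dist[of 0 "1/2"] by (simp add: \<gamma>0 u_def disk_dist_0)
    then have "\<eta> 0 = \<eta> (1/2)" by (intro disk_dist_eq_0_imp_eq disk) auto
    then show False using inj_onD[OF inj, of 0 "1/2"] by simp
  qed
  have pos: "cmod u *\<^sub>R \<gamma> r = cmod (\<gamma> r) *\<^sub>R u" if r: "0 \<le> r" "r < 1" for r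
  proof -
    have g: "\<gamma> r \<in> unit_disk" using r by (intro \<gamma>disk) auto
    have "\<gamma> r \<bullet> u = cmod (\<gamma> r) * cmod u"
    proof (cases "r \<le> 1/2")
      case True
      then have "disk_dist 0 u = disk_dist 0 (\<gamma> r) + disk_dist (\<gamma> r) u"
        using add[of 0 r "1/2"] \<gamma>dist[of 0 "1/2"] \<gamma>dist[of 0 r] \<gamma>dist[of r "1/2"] r
        by (simp add: \<gamma>0 u_def)
      then show ?thesis using inner_of_additive(1)[OF g udisk] by simp
    next
      case False
      then have "disk_dist 0 (\<gamma> r) = disk_dist 0 u + disk_dist u (\<gamma> r)"
        using add[of 0 "1/2" r] \<gamma>dist[of 0 "1/2"] \<gamma>dist[of 0 r] \<gamma>dist[of "1/2" r] r
        by (simp add: \<gamma>0 u_def)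
      then show ?thesis
        using inner_of_additive(1)[OF udisk g] by (simp add: inner_commute mult.commute)
    qed
    then show ?thesis using norm_cauchy_schwarz_eq[of "\<gamma> r" u] by simp
  qed
  have neg: "cmod u *\<^sub>R \<gamma> r = - (cmod (\<gamma> r) *\<^sub>R u)" if r: "-1 < r" "r < 0" for r
  proof -
    have g: "\<gamma> r \<in> unit_disk" using r by (intro \<gamma>disk) auto
    have "disk_dist (\<gamma> r) u = disk_dist (\<gamma> r) 0 + disk_dist 0 u"
      using add[of r 0 "1/2"] \<gamma>dist[of r "1/2"] \<gamma>dist[of r 0] \<gamma>dist[of 0 "1/2"] r
      by (simp add: \<gamma>0 u_def)
    then have "(- \<gamma> r) \<bullet> u = cmod (- \<gamma> r) * cmod u"
      using inner_of_additive(2)[OF g udisk] by simp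
    then show ?thesis using norm_cauchy_schwarz_eq[of "- \<gamma> r" u] by simp
  qed
  define t where "t = - Arg u"
  define E where "E = exp (\<i> * of_real t)"
  have Eu: "E * u = of_real (cmod u)"
  proof -
    have "E * u = E * (of_real (cmod u) * exp (\<i> * of_real (Arg u)))"
      using Arg_eq[OF \<open>u \<noteq> 0\<close>] by simp
    also have "\<dots> = of_real (cmod u)"
      unfolding E_def t_def by (simp add: exp_minus)
    finally show ?thesis .
  qed
  have M: "Moebius_function t c (\<eta> r) = E * \<gamma> r" for r
    by (simp add: \<gamma>_def Moebius_function_def E_def)
  define \<rho> where "\<rho> r = (if r < 0 then - cmod (\<gamma> r) else cmod (\<gamma> r))" for r
  have M\<rho>: "Moebius_function t c (\<eta> r) = of_real (\<rho> r)" if r: "-1 < r" "r < 1" for r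
  proof -
    have "cmod u *\<^sub>R \<gamma> r = \<rho> r *\<^sub>R u"
      using pos[of r] neg[of r] r by (auto simp: \<rho>_def)
    then have "of_real (cmod u) * (E * \<gamma> r) = of_real (\<rho> r) * (E * u)"
      by (simp add: scaleR_conv_of_real mult.left_commute)
    then show ?thesis unfolding M Eu using \<open>u \<noteq> 0\<close> by simp
  qed
  have \<rho>1: "\<bar>\<rho> r\<bar> < 1" if "-1 < r" "r < 1" for r
    using \<gamma>disk[OF that] by (simp add: \<rho>_def)
  have \<rho>dist: "disk_dist (\<eta> 0) (\<eta> r) = artanh \<bar>\<rho> r\<bar>" if "-1 < r" "r < 1" for r
    using \<gamma>dist[of 0 r] that by (simp add: \<gamma>0 disk_dist_0 \<rho>_def)
  have \<rho>cont: "continuous_on {-1<..<1} \<rho>"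
  proof -
    have "continuous_on {-1<..<1} (\<lambda>r. Re (Moebius_function t c (\<eta> r)))"
    proof (intro continuous_on_Re continuous_on_compose2[OF _ cont])
      show "continuous_on unit_disk (Moebius_function t c)"
        using c by (intro holomorphic_on_imp_continuous_on Moebius_function_holomorphic) auto
    qed (use disk in force)
    then show ?thesis
      by (rule continuous_on_eq) (auto simp: M\<rho>)
  qed
  have "x \<in> \<rho> ` {-1<..<1}" if x: "\<bar>x\<bar> < 1" for x
  proof -
    have "\<forall>\<^sub>F r in at_left 1. artanh \<bar>x\<bar> < disk_dist (\<eta> 0) (\<eta> r)"
      using lim1 by (simp add: filterlim_at_top_dense)
    then have "\<forall>\<^sub>F r in at_left 1. artanh \<bar>x\<bar> < disk_dist (\<eta> 0) (\<eta> r) \<and> r \<in> {0<..<1}"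
      by (intro eventually_conj eventually_at_left_real) auto
    then obtain r1 where r1: "artanh \<bar>x\<bar> < disk_dist (\<eta> 0) (\<eta> r1)" "0 < r1" "r1 < 1"
      using eventually_happens'[OF trivial_limit_at_left_real] by force
    have "\<forall>\<^sub>F r in at_right (-1). artanh \<bar>x\<bar> < disk_dist (\<eta> 0) (\<eta> r)"
      using lim2 by (simp add: filterlim_at_top_dense)
    then have "\<forall>\<^sub>F r in at_right (-1). artanh \<bar>x\<bar> < disk_dist (\<eta> 0) (\<eta> r) \<and> r \<in> {-1<..<0}"
      by (intro eventually_conj eventually_at_right_real) auto
    then obtain r2 where r2: "artanh \<bar>x\<bar> < disk_dist (\<eta> 0) (\<eta> r2)" "-1 < r2" "r2 < 0"
      using eventually_happens'[OF trivial_limit_at_right_real] by force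
    have "\<bar>x\<bar> < \<bar>\<rho> r1\<bar>" "\<bar>x\<bar> < \<bar>\<rho> r2\<bar>"
      using r1 r2 x \<rho>dist[of r1] \<rho>dist[of r2] \<rho>1[of r1] \<rho>1[of r2]
      by (auto intro!: artanh_strict_mono_imp)
    then have "\<rho> r2 \<le> x" "x \<le> \<rho> r1" using r1 r2 by (auto simp: \<rho>_def)
    moreover have "continuous_on {r2..r1} \<rho>"
      using r1 r2 by (intro continuous_on_subset[OF \<rho>cont]) auto
    ultimately obtain r where "r2 \<le> r" "r \<le> r1" "\<rho> r = x"
      using IVT'[of \<rho> r2 x r1] r1 r2 by auto
    then show ?thesis using r1 r2 by force
  qed
  then have "\<rho> ` {-1<..<1} = {-1<..<1}"
    using \<rho>1 by (force simp: abs_less_iff)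
  moreover have "Moebius_function t c ` \<eta> ` {-1<..<1} = complex_of_real ` \<rho> ` {-1<..<1}"
    unfolding image_image by (rule image_cong) (auto simp: M\<rho>)
  ultimately show ?thesis using that[of t] by (simp add: c_def)
qed

text \<open>Straightening the geodesic to the real diameter by an isometry, the nearest point exists and is unique,
so that the infimum and the definite description in the definitions both denote what they should, and
the points \<open>\<eta> 0\<close>, projection and \<open>w\<close> form a right-angled triangle.\<close>

lemma geodesic_projection:
  assumes geo: "full_geodesic \<eta>" and w: "w \<in> unit_disk"
  shows "curve_projection \<eta> w \<in> \<eta> ` {-1<..<1}"
    and "dist_to_curve w \<eta> = disk_dist w (curve_projection \<eta> w)"
    and "cosh (2 * disk_dist (\<eta> 0) w) =
         cosh (2 * disk_dist (\<eta> 0) (curve_projection \<eta> w)) * cosh (2 * dist_to_curve w \<eta>)"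
proof -
  have disk: "\<And>r. r \<in> {-1<..<1} \<Longrightarrow> \<eta> r \<in> unit_disk"
    using geo unfolding full_geodesic_def by blast
  have c: "\<eta> 0 \<in> unit_disk" by (rule disk) auto
  obtain t where t: "Moebius_function t (\<eta> 0) ` \<eta> ` {-1<..<1} = complex_of_real ` {-1<..<1}"
    using full_geodesic_straighten[OF geo] .
  define M where "M = Moebius_function t (\<eta> 0)"
  have iso: "disk_dist (M a) (M b) = disk_dist a b" if "a \<in> unit_disk" "b \<in> unit_disk" for a b
    unfolding M_def by (rule disk_dist_Moebius[OF c that])
  have M0: "M (\<eta> 0) = 0" by (simp add: M_def Moebius_function_eq_zero)
  have "M w \<in> unit_disk" unfolding M_def by (rule Moebius_function_in_disk[OF c w])
  then obtain x0 where x0: "\<bar>x0\<bar> < 1"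
    and min: "\<And>x. \<bar>x\<bar> < 1 \<Longrightarrow> disk_dist (M w) (of_real x0) \<le> disk_dist (M w) (of_real x)"
    and uniq: "\<And>x. \<bar>x\<bar> < 1 \<Longrightarrow> disk_dist (M w) (of_real x) = disk_dist (M w) (of_real x0) \<Longrightarrow> x = x0"
    and pyth: "cosh (2 * disk_dist 0 (M w)) =
         cosh (2 * disk_dist 0 (of_real x0)) * cosh (2 * disk_dist (M w) (of_real x0))"
    using diameter_projection by blast
  have "complex_of_real x0 \<in> M ` \<eta> ` {-1<..<1}" unfolding M_def t using x0 by (simp add: abs_less_iff)
  then obtain r0 where r0: "r0 \<in> {-1<..<1}" "M (\<eta> r0) = of_real x0" by auto
  have real: "\<exists>x. \<bar>x\<bar> < 1 \<and> M (\<eta> r) = of_real x" if "r \<in> {-1<..<1}" for r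
  proof -
    have "M (\<eta> r) \<in> complex_of_real ` {-1<..<1}" using t that unfolding M_def by blast
    then show ?thesis by (auto simp: abs_less_iff)
  qed
  have le: "disk_dist w (\<eta> r0) \<le> disk_dist w (\<eta> r)" if r: "r \<in> {-1<..<1}" for r
  proof -
    obtain x where "\<bar>x\<bar> < 1" "M (\<eta> r) = of_real x" using real[OF r] by blast
    then show ?thesis
      using min[of x] iso[OF w disk[OF r]] iso[OF w disk[OF r0(1)]] r0(2) by simp
  qed
  have unique: "\<eta> r = \<eta> r0"
    if r: "r \<in> {-1<..<1}" and eq: "disk_dist w (\<eta> r) = disk_dist w (\<eta> r0)" for r
  proof -
    obtain x where x: "\<bar>x\<bar> < 1" "M (\<eta> r) = of_real x" using real[OF r] by blast
    then have "x = x0"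
      using uniq[of x] eq iso[OF w disk[OF r]] iso[OF w disk[OF r0(1)]] r0(2) by simp
    then have "disk_dist (\<eta> r) (\<eta> r0) = 0"
      using iso[OF disk[OF r] disk[OF r0(1)]] x r0(2) by (simp add: disk_dist_def)
    then show ?thesis by (rule disk_dist_eq_0_imp_eq[OF disk[OF r] disk[OF r0(1)]])
  qed
  have inf: "dist_to_curve w \<eta> = disk_dist w (\<eta> r0)"
    unfolding dist_to_curve_def by (rule cInf_eq_minimum) (use r0 le in auto)
  have proj: "curve_projection \<eta> w = \<eta> r0"
    unfolding curve_projection_def
    by (rule the_equality) (use r0 unique inf in auto)
  show "curve_projection \<eta> w \<in> \<eta> ` {-1<..<1}" using r0 proj by blast
  show "dist_to_curve w \<eta> = disk_dist w (curve_projection \<eta> w)" by (simp add: inf proj)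
  show "cosh (2 * disk_dist (\<eta> 0) w) =
         cosh (2 * disk_dist (\<eta> 0) (curve_projection \<eta> w)) * cosh (2 * dist_to_curve w \<eta>)"
    using pyth iso[OF c w] iso[OF c disk[OF r0(1)]] iso[OF w disk[OF r0(1)]] r0(2)
    by (simp add: inf proj M0)
qed

section \<open>Right-angled hyperbolic triangles\<close>

text \<open>The product formula gives \<open>cosh (2 * c) = (cosh (2 * (a + b)) + cosh (2 * (a - b))) / 2\<close>. The upper bound
holds because the second term is at most the first. For the lower bound the second term is at least
\<open>1\<close>, and \<open>(cosh (2 * s) + 1) / 2 \<ge> cosh (2 * s - ln 2)\<close> whenever \<open>2 * s \<ge> ln 2\<close>. Bounding the
hyperbolic cosines separately by exponentials would only yield the constant \<open>ln 2\<close>.\<close>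

lemma hyperbolic_hypotenuse_bounds:
  fixes a b c :: real
  assumes "a \<ge> 0" "b \<ge> 0" "c \<ge> 0" and pyth: "cosh (2 * c) = cosh (2 * a) * cosh (2 * b)"
  shows "a + b - 1 / 2 * ln 2 \<le> c" and "c \<le> a + b"
proof -
  have "cosh (2 * c) \<le> cosh (2 * a) * cosh (2 * b) + sinh (2 * a) * sinh (2 * b)"
    using assms by simp
  also have "\<dots> = cosh (2 * (a + b))" by (simp add: cosh_add distrib_left)
  finally show "c \<le> a + b"
    using assms cosh_real_nonneg_le_iff[of "2 * c" "2 * (a + b)"] by simp
  show "a + b - 1 / 2 * ln 2 \<le> c"
  proof (cases "a + b - 1 / 2 * ln 2 \<le> 0")
    case True
    then show ?thesis using assms by linarith
  next
    case False
    \<comment> \<open>with \<open>x = exp (2 * s - ln 2)\<close>, the inequality reads \<open>x + 1 / x \<le> x + 1 + 1 / (4 * x)\<close>, true for \<open>x \<ge> 3/4\<close>\<close>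
    define x where "x = exp (2 * (a + b)) / 2"
    have ln2: "2 * (a + b - 1 / 2 * ln 2) = 2 * (a + b) - ln 2" by simp
    have x: "exp (2 * (a + b - 1 / 2 * ln 2)) = x"
      unfolding ln2 exp_diff x_def by simp
    have x1: "x \<ge> 1" unfolding x[symmetric] one_le_exp_iff using False by simp
    have "cosh (2 * (a + b - 1 / 2 * ln 2)) = (x + 1 / x) / 2"
      unfolding cosh_field_def exp_minus x by (simp add: inverse_eq_divide)
    also have "\<dots> \<le> (x + (1 + 1 / (4 * x))) / 2"
      using x1 by (simp add: field_simps)
    also have "\<dots> = (cosh (2 * (a + b)) + 1) / 2"
      unfolding cosh_field_def exp_minus x_def
      by (simp add: inverse_eq_divide add_divide_distrib)
    also have "\<dots> \<le> (cosh (2 * a + 2 * b) + cosh (2 * a - 2 * b)) / 2"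
      using cosh_real_ge_1[of "2 * a - 2 * b"] by simp
    also have "\<dots> = cosh (2 * c)"
      unfolding pyth by (simp add: cosh_add cosh_diff)
    finally show ?thesis
      using False assms(3) cosh_real_nonneg_le_iff[of "2 * (a + b - 1 / 2 * ln 2)" "2 * c"] by simp
  qed
qed

theorem corollary3p1:
  fixes \<phi> :: "real \<Rightarrow> complex \<Rightarrow> complex" and \<Delta> :: "complex set"
    and z :: complex and \<eta> :: "real \<Rightarrow> complex"
  assumes "disk_semigroup \<phi>" and "\<not> disk_group \<phi>"
    and "petal \<phi> \<Delta>" and "z \<in> \<Delta>"
    and "petal_geodesic \<phi> \<Delta> z \<eta>"
  shows "\<forall>t\<le>0.
      orthogonal_speed \<phi> \<Delta> z \<eta> t + tangential_speed \<phi> \<Delta> z \<eta> t - 1 / 2 * ln 2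
        \<le> total_speed \<phi> \<Delta> z t \<and>
      total_speed \<phi> \<Delta> z t
        \<le> orthogonal_speed \<phi> \<Delta> z \<eta> t + tangential_speed \<phi> \<Delta> z \<eta> t"
proof (intro allI impI)
  fix t :: real assume t: "t \<le> 0"
  define w where "w = backward_orbit \<phi> \<Delta> z t"
  define p where "p = curve_projection \<eta> w"
  have geo: "full_geodesic \<eta>" and \<eta>0: "\<eta> 0 = z"
    using assms(5) unfolding petal_geodesic_def by blast+
  have \<Delta>: "\<Delta> \<subseteq> unit_disk" by (rule petal_subset_disk[OF assms(1,3)])
  have z: "z \<in> unit_disk" using \<Delta> assms(4) by blast
  have w: "w \<in> unit_disk"
    using \<Delta> backward_orbit_in_petal[OF assms(1,3,4) t] unfolding w_def by blast
  have "p \<in> \<eta> ` {-1<..<1}" unfolding p_def by (rule geodesic_projection(1)[OF geo w])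
  then have p: "p \<in> unit_disk" using geo unfolding full_geodesic_def by blast
  have dist: "dist_to_curve w \<eta> = disk_dist w p"
    unfolding p_def by (rule geodesic_projection(2)[OF geo w])
  have "cosh (2 * disk_dist z w) = cosh (2 * disk_dist z p) * cosh (2 * disk_dist w p)"
    using geodesic_projection(3)[OF geo w] by (simp add: \<eta>0 dist flip: p_def)
  from hyperbolic_hypotenuse_bounds[OF disk_dist_nonneg[OF z p] disk_dist_nonneg[OF w p]
      disk_dist_nonneg[OF z w] this]
  show "orthogonal_speed \<phi> \<Delta> z \<eta> t + tangential_speed \<phi> \<Delta> z \<eta> t - 1 / 2 * ln 2
        \<le> total_speed \<phi> \<Delta> z t \<and>
      total_speed \<phi> \<Delta> z t
        \<le> orthogonal_speed \<phi> \<Delta> z \<eta> t + tangential_speed \<phi> \<Delta> z \<eta> t"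
    unfolding orthogonal_speed_def tangential_speed_def total_speed_def
      w_def[symmetric] p_def[symmetric] dist by blast
qed

end
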